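(* Let $e^{t\mathbf A}$, $t\ge0$, be a $C_0$-semigroup of type $(M,\omega)$ on a complex Banach space $B$, with generator $\mathbf A$. If $e^{t\mathbf A}$ has an analytic extension $e^{z\mathbf A}$ to the open sector $$S_\theta=\{z\in\mathbb C\mid z\ne0,\ |\arg z|<\theta\}$$ for some $\theta>0$, then $e^{z\mathbf A}$ is injective for every $z\in S_\theta$.
   Context: A $C_0$-semigroup $e^{t\mathbf A}\in\mathbb B(B)$ is of type $(M,\omega)$, with $M\ge1$ and $\omega\ge0$, if $\|e^{t\mathbf A}\|_{\mathbb B(B)}\le Me^{\omega t}$ for $0\le t<\infty$. Its analytic extension is an analytic semigroup $z\mapsto e^{z\mathbf A}\in\mathbb B(B)$ defined on $S_\theta$ that agrees with $e^{t\mathbf A}$ for $z=t>0$. *)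

theory Defs
  imports "HOL-Analysis.Analysis"
begin

class complex_normed_vector = real_normed_vector +
  fixes scaleC :: "complex \<Rightarrow> 'a \<Rightarrow> 'a" (infixr \<open>*\<^sub>C\<close> 75)
  assumes scaleC_add_right: "c *\<^sub>C (x + y) = c *\<^sub>C x + c *\<^sub>C y"
    and scaleC_add_left: "(c + d) *\<^sub>C x = c *\<^sub>C x + d *\<^sub>C x"
    and scaleC_scaleC: "c *\<^sub>C d *\<^sub>C x = (c * d) *\<^sub>C x"
    and scaleC_of_real: "of_real r *\<^sub>C x = r *\<^sub>R x"
    and norm_scaleC: "norm (c *\<^sub>C x) = cmod c * norm x"

class complex_banach = complex_normed_vector + banach

instantiation complex :: complex_banach
begin

definition scaleC_complex :: "complex \<Rightarrow> complex \<Rightarrow> complex"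
  where "scaleC_complex c x = c * x"

instance
  by standard (simp_all add: scaleC_complex_def distrib_left distrib_right norm_mult scaleR_conv_of_real)

end

lemma bounded_linear_scaleC: "bounded_linear ((*\<^sub>C) c :: 'a \<Rightarrow> 'a::complex_normed_vector)"
proof (rule bounded_linear_intro)
  fix x y :: 'a and r :: real
  show "c *\<^sub>C (x + y) = c *\<^sub>C x + c *\<^sub>C y"
    by (rule scaleC_add_right)
  show "c *\<^sub>C r *\<^sub>R x = r *\<^sub>R c *\<^sub>C x"
    by (simp only: scaleC_of_real[symmetric] scaleC_scaleC mult.commute[of c])
  show "norm (c *\<^sub>C x) \<le> norm x * cmod c"
    by (simp add: norm_scaleC)
qed

text \<open>The type \<^typ>\<open>'a \<Rightarrow>\<^sub>L 'b\<close> consists of the bounded real-linear maps. It is a complex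
  normed space as soon as the codomain is one; the complex-linear maps are the closed
  subspace \<open>cblinfuns\<close> below.\<close>

instantiation blinfun :: (real_normed_vector, complex_normed_vector) complex_normed_vector
begin

lift_definition scaleC_blinfun :: "complex \<Rightarrow> 'a \<Rightarrow>\<^sub>L 'b \<Rightarrow> 'a \<Rightarrow>\<^sub>L 'b"
  is "\<lambda>c f x. c *\<^sub>C f x"
  by (rule bounded_linear_compose[OF bounded_linear_scaleC])

instance
proof
  fix c d :: complex and r :: real and f g :: "'a \<Rightarrow>\<^sub>L 'b"
  show "c *\<^sub>C (f + g) = c *\<^sub>C f + c *\<^sub>C g"
    by transfer (simp add: scaleC_add_right)
  show "(c + d) *\<^sub>C f = c *\<^sub>C f + d *\<^sub>C f"
    by transfer (simp add: scaleC_add_left)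
  show "c *\<^sub>C d *\<^sub>C f = (c * d) *\<^sub>C f"
    by transfer (simp add: scaleC_scaleC)
  show "of_real r *\<^sub>C f = r *\<^sub>R f"
    by transfer (simp add: scaleC_of_real)
  have le: "norm (c *\<^sub>C f) \<le> cmod c * norm f" for c and f :: "'a \<Rightarrow>\<^sub>L 'b"
  proof (rule norm_blinfun_bound)
    fix x
    show "norm (blinfun_apply (c *\<^sub>C f) x) \<le> cmod c * norm f * norm x"
      by (simp add: scaleC_blinfun.rep_eq norm_scaleC mult.assoc mult_left_mono norm_blinfun)
  qed simp
  show "norm (c *\<^sub>C f) = cmod c * norm f"
  proof (cases "c = 0")
    case True
    then show ?thesis
      using le[of c f] by simp
  next
    case False
    have "inverse c *\<^sub>C c *\<^sub>C f = f"
      using False scaleC_of_real[of 1]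
      by (intro blinfun_eqI) (simp add: scaleC_blinfun.rep_eq scaleC_scaleC)
    then have "norm f \<le> inverse (cmod c) * norm (c *\<^sub>C f)"
      using le[of "inverse c" "c *\<^sub>C f"] by (simp add: norm_inverse)
    then have "cmod c * norm f \<le> norm (c *\<^sub>C f)"
      using False by (simp add: field_simps)
    with le[of c f] show ?thesis
      by (rule antisym)
  qed
qed

end

instance blinfun :: (real_normed_vector, complex_banach) complex_banach ..

definition cblinfuns :: "('a::complex_normed_vector \<Rightarrow>\<^sub>L 'b::complex_normed_vector) set"
  where "cblinfuns = {f. \<forall>c x. blinfun_apply f (c *\<^sub>C x) = c *\<^sub>C blinfun_apply f x}"

text \<open>\<^const>\<open>holomorphic_on\<close> only covers complex-valued maps.\<close>

definition vector_holomorphic_on :: "(complex \<Rightarrow> 'a::complex_normed_vector) \<Rightarrow> complex set \<Rightarrow> bool"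
    (infixl \<open>vector'_holomorphic'_on\<close> 50)
  where "F vector_holomorphic_on S \<longleftrightarrow>
    (\<forall>z\<in>S. \<exists>D. ((\<lambda>w. inverse (w - z) *\<^sub>C (F w - F z)) \<longlongrightarrow> D) (at z within S))"

text \<open>Semigroups are total functions on \<^typ>\<open>real\<close>; only their values at \<open>t \<ge> 0\<close> matter.\<close>

definition C0_semigroup :: "(real \<Rightarrow> 'a::complex_banach \<Rightarrow>\<^sub>L 'a) \<Rightarrow> bool"
  where "C0_semigroup T \<longleftrightarrow>
    (\<forall>t\<ge>0. T t \<in> cblinfuns) \<and>
    T 0 = id_blinfun \<and>
    (\<forall>s\<ge>0. \<forall>t\<ge>0. T (s + t) = T s o\<^sub>L T t) \<and>
    (\<forall>x. ((\<lambda>t. blinfun_apply (T t) x) \<longlongrightarrow> x) (at_right 0))"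

definition semigroup_of_type :: "(real \<Rightarrow> 'a::complex_banach \<Rightarrow>\<^sub>L 'a) \<Rightarrow> real \<Rightarrow> real \<Rightarrow> bool"
  where "semigroup_of_type T M \<omega> \<longleftrightarrow>
    M \<ge> 1 \<and> \<omega> \<ge> 0 \<and> (\<forall>t\<ge>0. norm (T t) \<le> M * exp (\<omega> * t))"

text \<open>The generator is in general unbounded and only densely defined, so it is represented
  by its graph; its domain is \<^term>\<open>Domain (semigroup_generator T)\<close>.\<close>

definition semigroup_generator :: "(real \<Rightarrow> 'a::complex_banach \<Rightarrow>\<^sub>L 'a) \<Rightarrow> ('a \<times> 'a) set"
  where "semigroup_generator T =
    {(x, y). ((\<lambda>t. inverse t *\<^sub>R (blinfun_apply (T t) x - x)) \<longlongrightarrow> y) (at_right 0)}"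

definition open_sector :: "real \<Rightarrow> complex set"
  where "open_sector \<theta> = {z. z \<noteq> 0 \<and> \<bar>Arg z\<bar> < \<theta>}"

text \<open>For \<open>\<theta> > \<pi> / 2\<close> the sector is not closed under addition, hence the
  restriction to \<open>z + w\<close> in the sector.\<close>

definition analytic_semigroup_on :: "(complex \<Rightarrow> 'a::complex_banach \<Rightarrow>\<^sub>L 'a) \<Rightarrow> real \<Rightarrow> bool"
  where "analytic_semigroup_on F \<theta> \<longleftrightarrow>
    (\<forall>z\<in>open_sector \<theta>. F z \<in> cblinfuns) \<and>
    F vector_holomorphic_on open_sector \<theta> \<and>
    (\<forall>z\<in>open_sector \<theta>. \<forall>w\<in>open_sector \<theta>.
      z + w \<in> open_sector \<theta> \<longrightarrow> F (z + w) = F z o\<^sub>L F w)"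

definition analytic_extension ::
    "(real \<Rightarrow> 'a::complex_banach \<Rightarrow>\<^sub>L 'a) \<Rightarrow> real \<Rightarrow> (complex \<Rightarrow> 'a \<Rightarrow>\<^sub>L 'a) \<Rightarrow> bool"
  where "analytic_extension T \<theta> F \<longleftrightarrow>
    analytic_semigroup_on F \<theta> \<and> (\<forall>t>0. F (of_real t) = T t)"

end

theory Submission
  imports Defs "HOL-Complex_Analysis.Complex_Analysis"
begin

text \<open>If \<open>F z x = 0\<close>, the semigroup law gives \<open>F (z + t) x = F t (F z x) = 0\<close> for small
  \<open>t > 0\<close>, so the orbit \<open>w \<mapsto> F w x\<close> vanishes on a set accumulating at \<open>z\<close>. By the identity
  theorem it vanishes on the whole sector, in particular \<open>T t x = 0\<close> for \<open>t > 0\<close>, and strong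
  continuity at \<open>0\<close> yields \<open>x = 0\<close>. The identity theorem for vector-valued maps is reduced to the
  scalar one by the Hahn--Banach theorem.\<close>

section \<open>The Hahn-Banach theorem: norming and separating functionals\<close>

text \<open>A functional dominated by the norm is encoded by its graph. A subspace whose elements
  satisfy this bound is automatically single-valued, since \<open>(0, r)\<close> in it forces \<open>r \<le> 0\<close> and
  \<open>- r \<le> 0\<close>.\<close>

definition dominated_graph :: "('a::real_normed_vector \<times> real) set \<Rightarrow> bool"
  where "dominated_graph g \<longleftrightarrow> subspace g \<and> (\<forall>(v, r)\<in>g. r \<le> norm v)"

lemma dominated_graphD:
  assumes "dominated_graph g" "(v, r) \<in> g"
  shows "r \<le> norm v"
  using assms by (auto simp: dominated_graph_def)

lemma dominated_graph_add:
  assumes "dominated_graph g" "(u, r) \<in> g" "(v, s) \<in> g"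
  shows "(u + v, r + s) \<in> g"
  using assms subspace_add[of g "(u, r)" "(v, s)"] by (simp add: dominated_graph_def)

lemma dominated_graph_scale:
  assumes "dominated_graph g" "(u, r) \<in> g"
  shows "(c *\<^sub>R u, c * r) \<in> g"
  using assms subspace_scale[of g "(u, r)" c] by (simp add: dominated_graph_def)

lemma dominated_graph_unique:
  assumes g: "dominated_graph g" and "(v, r) \<in> g" "(v, s) \<in> g"
  shows "r = s"
proof -
  have le: "a \<le> b" if "(v, a) \<in> g" "(v, b) \<in> g" for a b
    using dominated_graphD[OF g dominated_graph_add[OF g that(1) dominated_graph_scale[OF g that(2), of "-1"]]]
    by simp
  show ?thesis
    using assms by (intro antisym le)
qed

text \<open>These unions are the upper bounds for Zorn's lemma. Two elements of the union lie in a
  common member, since a chain is ordered by inclusion, so sums stay inside;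
  \<open>C \<noteq> {}\<close> supplies \<open>0\<close>.\<close>

lemma dominated_graph_Union:
  assumes "C \<noteq> {}" "subset.chain (Collect dominated_graph) C"
  shows "dominated_graph (\<Union>C)"
proof -
  have C: "dominated_graph g" if "g \<in> C" for g
    using assms that by (auto simp: subset_chain_def)
  have "subspace (\<Union>C)"
    unfolding subspace_def
  proof (intro conjI ballI allI)
    show "0 \<in> \<Union>C"
      using assms(1) C by (auto simp: dominated_graph_def subspace_0)
  next
    fix x y assume "x \<in> \<Union>C" "y \<in> \<Union>C"
    then obtain g h where gh: "g \<in> C" "x \<in> g" "h \<in> C" "y \<in> h"
      by blast
    then consider "g \<subseteq> h" | "h \<subseteq> g"
      using assms(2) by (meson subset_chain_def)
    then show "x + y \<in> \<Union>C"
      using gh C by cases (metis UnionI dominated_graph_def subsetD subspace_add)+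
  next
    fix c :: real and x assume "x \<in> \<Union>C"
    then show "c *\<^sub>R x \<in> \<Union>C"
      using C by (meson Union_iff dominated_graph_def subspace_scale)
  qed
  then show ?thesis
    using C by (fastforce simp: dominated_graph_def)
qed

text \<open>One-dimensional extension step of Hahn-Banach. A value \<open>c\<close> at
  \<open>v\<close> must satisfy \<open>s - norm (w - v) \<le> c \<le> norm (u + v) - r\<close> for
  all \<open>(w, s)\<close> and \<open>(u, r)\<close> in \<open>g\<close>. The triangle inequality
  makes these bounds compatible, and \<open>c\<close> is the supremum of the lower ones. If
  \<open>v\<close> already has a value, the bounds force \<open>c\<close> to be that value.\<close>

lemma dominated_graph_extend:
  fixes v :: "'a::real_normed_vector"
  assumes g: "dominated_graph g"
  obtains c where "dominated_graph (span (insert (v, c) g))"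
proof -
  define L where "L = {s - norm (w - v) |w s. (w, s) \<in> g}"
  have 0: "(0, 0) \<in> g"
    using g subspace_0[of g] by (simp add: dominated_graph_def zero_prod_def)
  have sep: "s - norm (w - v) \<le> norm (u + v) - r" if "(w, s) \<in> g" "(u, r) \<in> g" for w s u r
  proof -
    have "s + r \<le> norm (w + u)"
      by (rule dominated_graphD[OF g dominated_graph_add[OF g that]])
    also have "\<dots> \<le> norm (w - v) + norm (u + v)"
      using norm_triangle_ineq[of "w - v" "u + v"] by simp
    finally show ?thesis
      by simp
  qed
  have ne: "L \<noteq> {}"
    using 0 by (auto simp: L_def)
  have "s - norm (w - v) \<le> norm v" if "(w, s) \<in> g" for w s
    using sep[OF that 0] by simp
  then have bdd: "bdd_above L"
    by (intro bdd_aboveI[of _ "norm v"]) (auto simp: L_def)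
  define c where "c = Sup L"
  have lower: "s - norm (w - v) \<le> c" if "(w, s) \<in> g" for w s
    unfolding c_def using that by (intro cSup_upper bdd) (auto simp: L_def)
  have upper: "c \<le> norm (u + v) - r" if "(u, r) \<in> g" for u r
    unfolding c_def using that sep by (intro cSup_least ne) (auto simp: L_def)
  \<comment> \<open>Since \<open>g\<close> is closed under scaling, dividing by the absolute value
    of \<open>t\<close> reduces this to \<open>t = 1\<close>, which is \<open>upper\<close>, and
    \<open>t = -1\<close>, which is \<open>lower\<close>.\<close>
  have bound: "r + t * c \<le> norm (u + t *\<^sub>R v)" if ur: "(u, r) \<in> g" for u r t
  proof -
    consider "t = 0" | "t > 0" | "t < 0"
      by linarith
    then show ?thesis
    proof cases
      case 1
      then show ?thesis
        using dominated_graphD[OF g ur] by simp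
    next
      case 2
      have "t * c \<le> t * (norm (inverse t *\<^sub>R u + v) - inverse t * r)"
        using 2 by (intro mult_left_mono upper[OF dominated_graph_scale[OF g ur]]) simp
      then have "t * c \<le> t * norm (inverse t *\<^sub>R u + v) - r"
        using 2 by (simp add: right_diff_distrib mult.assoc[symmetric])
      moreover have "t * norm (inverse t *\<^sub>R u + v) = norm (u + t *\<^sub>R v)"
        using norm_scaleR[of t "inverse t *\<^sub>R u + v"] 2 by (simp add: scaleR_add_right)
      ultimately show ?thesis
        by simp
    next
      case 3
      define a where "a = - t"
      have a: "a > 0" "t = - a"
        using 3 by (simp_all add: a_def)
      have "a * (inverse a * r - norm (inverse a *\<^sub>R u - v)) \<le> a * c"
        using a(1) by (intro mult_left_mono lower[OF dominated_graph_scale[OF g ur]]) simp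
      then have "r - a * norm (inverse a *\<^sub>R u - v) \<le> a * c"
        using a(1) by (simp add: right_diff_distrib mult.assoc[symmetric])
      moreover have "a * norm (inverse a *\<^sub>R u - v) = norm (u - a *\<^sub>R v)"
        using norm_scaleR[of a "inverse a *\<^sub>R u - v"] a by (simp add: scaleR_diff_right)
      ultimately show ?thesis
        by (simp add: a)
    qed
  qed
  have "dominated_graph (span (insert (v, c) g))"
    unfolding dominated_graph_def
  proof (intro conjI subspace_span, clarify)
    fix w s assume "(w, s) \<in> span (insert (v, c) g)"
    then obtain k where "(w, s) - k *\<^sub>R (v, c) \<in> span g"
      by (auto simp: span_breakdown_eq)
    moreover have "span g = g"
      using g by (simp add: dominated_graph_def span_eq_iff)
    ultimately have "(w - k *\<^sub>R v, s - k * c) \<in> g"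
      by simp
    from bound[OF this, of k] show "s \<le> norm w"
      by simp
  qed
  then show ?thesis
    by (rule that)
qed

text \<open>Zorn's lemma yields a maximal dominated graph through \<open>(x, norm x)\<close>; the
  extension step forces its domain to be the whole space.\<close>

theorem Hahn_Banach_norming_functional:
  fixes x :: "'a::real_normed_vector"
  obtains f :: "'a \<Rightarrow> real" where "bounded_linear f" "\<And>v. \<bar>f v\<bar> \<le> norm v" "f x = norm x"
proof -
  let ?X = "{g. dominated_graph g \<and> (x, norm x) \<in> g}"
  \<comment> \<open>The starting functional on the line through \<open>x\<close> sends
    \<open>t *\<^sub>R x\<close> to \<open>t * norm x\<close>; it is dominated because
    \<open>t \<le> \<bar>t\<bar>\<close>.\<close>
  have "dominated_graph (span {(x, norm x)})"
    unfolding dominated_graph_def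
    by (intro conjI subspace_span) (auto simp: span_singleton intro!: mult_right_mono)
  then have "span {(x, norm x)} \<in> ?X"
    by (simp add: span_base)
  moreover have "\<Union>C \<in> ?X" if "C \<noteq> {}" "subset.chain ?X C" for C
  proof -
    have "subset.chain (Collect dominated_graph) C"
      using that(2) by (auto simp: subset_chain_def)
    then show ?thesis
      using that dominated_graph_Union[of C] by (auto simp: subset_chain_def)
  qed
  ultimately have "\<exists>g\<in>?X. \<forall>h\<in>?X. g \<subseteq> h \<longrightarrow> h = g"
    by (intro subset_Zorn_nonempty) blast+
  \<comment> \<open>Any \<open>h\<close> containing \<open>g\<close> inherits the point
    \<open>(x, norm x)\<close>, so maximality within \<open>?X\<close> is maximality among all
    dominated graphs.\<close>
  then obtain g where g: "dominated_graph g" and x: "(x, norm x) \<in> g"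
    and max: "\<And>h. dominated_graph h \<Longrightarrow> g \<subseteq> h \<Longrightarrow> h = g"
    by blast
  have total: "\<exists>r. (v, r) \<in> g" for v
  proof -
    obtain c where c: "dominated_graph (span (insert (v, c) g))"
      using dominated_graph_extend[OF g] by blast
    have "insert (v, c) g \<subseteq> span (insert (v, c) g)"
      by (rule span_superset)
    then show ?thesis
      using max[OF c] by blast
  qed
  define f where "f v = (THE r. (v, r) \<in> g)" for v
  have fI: "f v = r" if "(v, r) \<in> g" for v r
    unfolding f_def using that dominated_graph_unique[OF g] by blast
  have f: "(v, f v) \<in> g" for v
    using total[of v] fI by auto
  have add: "f (u + v) = f u + f v" for u v
    by (intro fI dominated_graph_add g f)
  have scale: "f (c *\<^sub>R v) = c * f v" for c v
    by (intro fI dominated_graph_scale g f)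
  \<comment> \<open>The one-sided bound at \<open>- v\<close> is the lower bound at
    \<open>v\<close>.\<close>
  have abs: "\<bar>f v\<bar> \<le> norm v" for v
    using dominated_graphD[OF g f[of v]] dominated_graphD[OF g f[of "- v"]] scale[of "-1" v]
    by simp
  have "bounded_linear f"
    by (rule bounded_linear_intro[where K = 1]) (use add scale abs in auto)
  then show ?thesis
    using abs fI[OF x] by (rule that)
qed

text \<open>The complex functional with real part \<open>f\<close> is \<open>v \<mapsto> f v - \<i> f (\<i> v)\<close>.\<close>

corollary complex_functional_nonzero:
  fixes x :: "'a::complex_normed_vector"
  assumes "x \<noteq> 0"
  obtains h :: "'a \<Rightarrow> complex"
  where "bounded_linear h" "\<And>c v. h (c *\<^sub>C v) = c * h v" "h x \<noteq> 0"
proof -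
  obtain f :: "'a \<Rightarrow> real" where f: "bounded_linear f" "f x = norm x"
    using Hahn_Banach_norming_functional by blast
  interpret f: bounded_linear f
    by (rule f)
  define h where "h v = complex_of_real (f v) - \<i> * complex_of_real (f (\<i> *\<^sub>C v))" for v
  have "bounded_linear (\<lambda>v. f (\<i> *\<^sub>C v))"
    by (rule bounded_linear_compose[OF f(1) bounded_linear_scaleC])
  then have bl: "bounded_linear h"
    unfolding h_def using f(1)
    by (intro bounded_linear_sub bounded_linear_const_mult
        bounded_linear_compose[OF bounded_linear_of_real])
  have scale: "h (c *\<^sub>C v) = c * h v" for c v
  proof -
    \<comment> \<open>Real linearity of \<open>f\<close> reduces complex scaling to
      \<open>f v\<close> and \<open>f (\<i> *\<^sub>C v)\<close>. Used for both \<open>c\<close> and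
      \<open>\<i> * c\<close>, this leaves a comparison of real and imaginary parts.\<close>
    have 1: "f (c *\<^sub>C v) = Re c * f v + Im c * f (\<i> *\<^sub>C v)" for c v
    proof -
      have "c *\<^sub>C v = Re c *\<^sub>R v + Im c *\<^sub>R (\<i> *\<^sub>C v)"
        by (simp add: scaleC_of_real[symmetric] scaleC_scaleC scaleC_add_left[symmetric]
            complex_eq[symmetric] mult.commute)
      then show ?thesis
        by (simp add: f.add f.scaleR)
    qed
    show ?thesis
      unfolding h_def scaleC_scaleC 1[of c] 1[of "\<i> * c"] by (simp add: complex_eq_iff)
  qed
  have "Re (h x) = norm x"
    by (simp add: h_def f)
  then have "h x \<noteq> 0"
    using assms by auto
  with bl scale show ?thesis
    by (rule that)
qed

section \<open>Connectedness and openness of the sector\<close>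

text \<open>Polar coordinates present the sector as a continuous image of a product of intervals,
  hence as connected. This covers \<open>\<theta> > pi\<close> too, where several angles may give
  the same point.\<close>

lemma open_sector_eq_image:
  assumes "\<theta> > 0"
  shows "open_sector \<theta> = (\<lambda>(r, a). of_real r * cis a) ` ({0<..} \<times> {-\<theta><..<\<theta>})"
proof (intro equalityI subsetI)
  fix z assume z: "z \<in> open_sector \<theta>"
  then have "z = of_real (cmod z) * cis (Arg z)"
    using rcis_cmod_Arg[of z] by (simp add: rcis_def)
  then show "z \<in> (\<lambda>(r, a). of_real r * cis a) ` ({0<..} \<times> {-\<theta><..<\<theta>})"
    using z by (intro image_eqI[of _ _ "(cmod z, Arg z)"]) (auto simp: open_sector_def)
next
  fix z assume "z \<in> (\<lambda>(r, a). of_real r * cis a) ` ({0<..} \<times> {-\<theta><..<\<theta>})"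
  then obtain r a where ra: "r > 0" "\<bar>a\<bar> < \<theta>" "z = of_real r * cis a"
    by force
  have "\<bar>Arg z\<bar> \<le> \<bar>a\<bar>"
  proof (cases "- pi < a \<and> a \<le> pi")
    case True
    then show ?thesis
      using ra by (simp add: Arg_times_of_real2 Arg_cis)
  next
    \<comment> \<open>Here the absolute value of \<open>a\<close> is at least \<open>pi\<close>,
      which \<open>\<bar>Arg z\<bar>\<close> never exceeds.\<close>
    case False
    then show ?thesis
      using mpi_less_Arg[of z] Arg_le_pi[of z] by linarith
  qed
  then show "z \<in> open_sector \<theta>"
    using ra by (auto simp: open_sector_def)
qed

lemma connected_open_sector:
  assumes "\<theta> > 0"
  shows "connected (open_sector \<theta>)"
  unfolding open_sector_eq_image[OF assms]
  by (intro connected_continuous_image connected_Times)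
    (auto simp: case_prod_unfold intro!: continuous_intros)

text \<open>\<open>Arg\<close> jumps across the negative real axis. For \<open>\<theta> > pi\<close>
  the sector is the punctured plane; otherwise it avoids that axis, where \<open>Arg\<close> is
  \<open>pi\<close>, and is an open preimage on the slit plane, where \<open>Arg\<close> is
  continuous.\<close>

lemma open_open_sector: "open (open_sector \<theta>)"
proof (cases "\<theta> > pi")
  case True
  have "\<bar>Arg z\<bar> < \<theta>" for z
    using True mpi_less_Arg[of z] Arg_le_pi[of z] by linarith
  then have "open_sector \<theta> = - {0}"
    by (auto simp: open_sector_def)
  then show ?thesis
    by (simp add: open_Compl)
next
  case False
  have "open_sector \<theta> = - \<real>\<^sub>\<le>\<^sub>0 \<inter> (\<lambda>z. \<bar>Arg z\<bar>) -` {..<\<theta>}"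
  proof (intro equalityI subsetI)
    fix z assume z: "z \<in> open_sector \<theta>"
    have "z \<notin> \<real>\<^sub>\<le>\<^sub>0"
    proof
      assume "z \<in> \<real>\<^sub>\<le>\<^sub>0"
      then have "Arg z = pi"
        using z by (auto simp: open_sector_def Arg_eq_pi complex_nonpos_Reals_iff complex_eq_iff)
      then show False
        using z False by (simp add: open_sector_def)
    qed
    then show "z \<in> - \<real>\<^sub>\<le>\<^sub>0 \<inter> (\<lambda>z. \<bar>Arg z\<bar>) -` {..<\<theta>}"
      using z by (simp add: open_sector_def)
  qed (auto simp: open_sector_def)
  moreover have "continuous_on (- \<real>\<^sub>\<le>\<^sub>0) (\<lambda>z. \<bar>Arg z\<bar>)"
    by (intro continuous_at_imp_continuous_on ballI continuous_rabs continuous_at_Arg) simp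
  ultimately show ?thesis
    by (simp add: continuous_open_preimage open_Compl)
qed

lemma of_real_in_open_sector:
  assumes "t > 0" "\<theta> > 0"
  shows "complex_of_real t \<in> open_sector \<theta>"
  using assms by (simp add: open_sector_def Arg_of_real)

section \<open>The identity theorem for orbits of operator-valued holomorphic maps\<close>

text \<open>Evaluation at \<open>x\<close> followed by \<open>h\<close> is continuous, so it carries
  the limit of difference quotients to the limit \<open>h (D x)\<close>; complex homogeneity of
  \<open>h\<close> lets the factor \<open>inverse (w - z)\<close> pass through.\<close>

lemma vector_holomorphic_on_functional:
  fixes F :: "complex \<Rightarrow> 'a::real_normed_vector \<Rightarrow>\<^sub>L 'b::complex_normed_vector"
  assumes F: "F vector_holomorphic_on S"
    and h: "bounded_linear h" "\<And>c v. h (c *\<^sub>C v) = c * h v"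
  shows "(\<lambda>w. h (blinfun_apply (F w) x)) holomorphic_on S"
  unfolding holomorphic_on_def
proof
  fix z assume "z \<in> S"
  then obtain D where "((\<lambda>w. inverse (w - z) *\<^sub>C (F w - F z)) \<longlongrightarrow> D) (at z within S)"
    using F by (auto simp: vector_holomorphic_on_def)
  then have "((\<lambda>w. h (blinfun_apply (inverse (w - z) *\<^sub>C (F w - F z)) x)) \<longlongrightarrow> h (blinfun_apply D x))
      (at z within S)"
    by (intro bounded_linear.tendsto[OF h(1)] blinfun.tendsto tendsto_const)
  then have "((\<lambda>w. h (blinfun_apply (F w) x)) has_field_derivative h (blinfun_apply D x)) (at z within S)"
    by (simp add: has_field_derivative_iff scaleC_blinfun.rep_eq h(2) blinfun.diff_left
        linear_diff[OF bounded_linear.linear[OF h(1)]] divide_inverse mult.commute)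
  then show "(\<lambda>w. h (blinfun_apply (F w) x)) field_differentiable at z within S"
    by (auto simp: field_differentiable_def)
qed

text \<open>With \<open>w\<close> fixed, a single functional \<open>h\<close> detecting a nonzero
  value at \<open>w\<close> suffices: its composition with the orbit is a scalar holomorphic
  function vanishing on \<open>U\<close>, hence at \<open>w\<close>.\<close>

lemma vector_identity_theorem:
  fixes F :: "complex \<Rightarrow> 'a::real_normed_vector \<Rightarrow>\<^sub>L 'b::complex_normed_vector"
  assumes F: "F vector_holomorphic_on S" and S: "open S" "connected S"
    and U: "U \<subseteq> S" "z \<in> S" "z islimpt U" "\<And>w. w \<in> U \<Longrightarrow> blinfun_apply (F w) x = 0"
    and w: "w \<in> S"
  shows "blinfun_apply (F w) x = 0"
proof (rule ccontr)
  assume "blinfun_apply (F w) x \<noteq> 0"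
  then obtain h :: "'b \<Rightarrow> complex" where h: "bounded_linear h" "\<And>c v. h (c *\<^sub>C v) = c * h v"
    and nz: "h (blinfun_apply (F w) x) \<noteq> 0"
    using complex_functional_nonzero by blast
  have "h (blinfun_apply (F w) x) = 0"
    using vector_holomorphic_on_functional[OF F h] S U(1-3) _ w
    by (rule analytic_continuation)
      (simp add: U(4) linear_0[OF bounded_linear.linear[OF h(1)]])
  with nz show False
    by contradiction
qed

section \<open>Injectivity on the sector\<close>

theorem proposition2:
  fixes T :: "real \<Rightarrow> 'a::complex_banach \<Rightarrow>\<^sub>L 'a"
    and F :: "complex \<Rightarrow> 'a \<Rightarrow>\<^sub>L 'a"
    and A :: "('a \<times> 'a) set"
    and M \<omega> \<theta> :: real
  assumes "C0_semigroup T"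
    and "semigroup_of_type T M \<omega>"
    and "A = semigroup_generator T"
    and "\<theta> > 0"
    and "analytic_extension T \<theta> F"
  shows "\<forall>z\<in>open_sector \<theta>. inj (blinfun_apply (F z))"
proof
  fix z assume z: "z \<in> open_sector \<theta>"
  let ?S = "open_sector \<theta>"
  have hol: "F vector_holomorphic_on ?S"
    and semi: "\<And>z w. z \<in> ?S \<Longrightarrow> w \<in> ?S \<Longrightarrow> z + w \<in> ?S \<Longrightarrow> F (z + w) = F z o\<^sub>L F w"
    and T: "\<And>t. t > 0 \<Longrightarrow> F (of_real t) = T t"
    using assms(5) by (auto simp: analytic_extension_def analytic_semigroup_on_def)
  have "x = 0" if x: "blinfun_apply (F z) x = 0" for x
  proof -
    \<comment> \<open>Membership in the sector makes the semigroup law applicable; openness of the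
      sector admits all small \<open>t\<close>, so \<open>z\<close> is a limit point.\<close>
    define U where "U = {of_real t + z |t. t > 0 \<and> of_real t + z \<in> ?S}"
    have "z islimpt U"
      unfolding islimpt_approachable
    proof (intro allI impI)
      fix e :: real assume "e > 0"
      obtain d where d: "d > 0" "ball z d \<subseteq> ?S"
        using open_open_sector z openE by blast
      \<comment> \<open>Being below \<open>d\<close> keeps the translate in the sector, being below
        \<open>e\<close> keeps it close to \<open>z\<close>, and \<open>t > 0\<close> keeps it
        different from \<open>z\<close>.\<close>
      define t where "t = min d e / 2"
      have t: "t > 0" "t < d" "t < e"
        using d \<open>e > 0\<close> by (auto simp: t_def)
      then have "of_real t + z \<in> ball z d"
        by (simp add: dist_norm)
      then have "of_real t + z \<in> U"
        using t d by (auto simp: U_def)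
      moreover have "of_real t + z \<noteq> z" "dist (of_real t + z) z < e"
        using t by (simp_all add: dist_norm)
      ultimately show "\<exists>w\<in>U. w \<noteq> z \<and> dist w z < e"
        by blast
    qed
    moreover have "blinfun_apply (F w) x = 0" if w: "w \<in> U" for w
    proof -
      obtain t where t: "t > 0" "w = of_real t + z" "of_real t + z \<in> ?S"
        using w by (auto simp: U_def)
      \<comment> \<open>The summands are ordered so that \<open>F z\<close> acts first and already
        annihilates \<open>x\<close>.\<close>
      then have "F w = F (of_real t) o\<^sub>L F z"
        using semi of_real_in_open_sector[OF _ assms(4)] z by metis
      then show ?thesis
        by (simp add: x blinfun.zero_right)
    qed
    moreover have "U \<subseteq> ?S"
      by (auto simp: U_def)
    ultimately have "blinfun_apply (F w) x = 0" if "w \<in> ?S" for w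
      using vector_identity_theorem[OF hol open_open_sector connected_open_sector[OF assms(4)] _ z _ _ that]
      by blast
    then have "blinfun_apply (T t) x = 0" if "t > 0" for t
      using T[OF that] of_real_in_open_sector[OF that assms(4)] by metis
    \<comment> \<open>The orbit is identically zero for \<open>t > 0\<close>, so its right limit at
      \<open>0\<close> is \<open>0\<close>; strong continuity says the same limit is
      \<open>x\<close>.\<close>
    then have "((\<lambda>t. blinfun_apply (T t) x) \<longlongrightarrow> 0) (at_right 0)"
      by (intro tendsto_eventually eventually_mono[OF eventually_at_right_less])
    moreover have "((\<lambda>t. blinfun_apply (T t) x) \<longlongrightarrow> x) (at_right 0)"
      using assms(1) by (auto simp: C0_semigroup_def)
    ultimately show "x = 0"
      using tendsto_unique trivial_limit_at_right_real by blast
  qed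
  then show "inj (blinfun_apply (F z))"
    by (simp add: linear_injective_0[OF bounded_linear.linear[OF blinfun.bounded_linear_right]])
qed

end
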